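(* Let $((\mathfrak g,[\cdot,\cdot],[\![\cdot,\cdot,\cdot]\!]),B)$ be a quadratic Lie-Yamaguti algebra, $N:\mathfrak g\to\mathfrak g$ a Nijenhuis operator on $\mathfrak g$, and $R:\mathfrak g\to\mathfrak g$ a skew-symmetric endomorphism of $(\mathfrak g,B)$. Set $\pi^\sharp=R\circ B^\sharp$ (with $\pi\in\wedge^2\mathfrak g$ the corresponding element) and assume that $B$ and $N$ are compatible, i.e. $B^\sharp\circ N^*=N\circ B^\sharp$. Then: (i) If $(R,N)$ is a Rota-Baxter-Nijenhuis structure on $\mathfrak g$, then $(\pi,N)$ is an $r$-matrix-Nijenhuis structure on $\mathfrak g$. (ii) If $(\pi,N)$ is an $r$-matrix-Nijenhuis structure on $\mathfrak g$, then $(R=\pi^\sharp\circ(B^\sharp)^{-1},N)$ is a Rota-Baxter-Nijenhuis structure on $\mathfrak g$.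
   Context: All vector spaces are finite-dimensional over a field $\mathbb K$ of characteristic $0$. A Lie-Yamaguti algebra is a vector space $\mathfrak g$ with a bilinear map $[\cdot,\cdot]:\wedge^2\mathfrak g\to\mathfrak g$ and a trilinear map $[\![\cdot,\cdot,\cdot]\!]:\wedge^2\mathfrak g\otimes\mathfrak g\to\mathfrak g$ such that for all $x,y,z,w,t\in\mathfrak g$: (1) $[[x,y],z]+[[y,z],x]+[[z,x],y]+[\![x,y,z]\!]+[\![y,z,x]\!]+[\![z,x,y]\!]=0$; (2) $[\![[x,y],z,w]\!]+[\![[y,z],x,w]\!]+[\![[z,x],y,w]\!]=0$; (3) $[\![x,y,[z,w]]\!]=[[\![x,y,z]\!],w]+[z,[\![x,y,w]\!]]$; (4) $[\![x,y,[\![z,w,t]\!]]\!]=[\![[\![x,y,z]\!],w,t]\!]+[\![z,[\![x,y,w]\!],t]\!]+[\![z,w,[\![x,y,t]\!]]\!]$. Nijenhuis operator: a linear map $N:\mathfrak g\to\mathfrak g$ such that, with $[x,y]_N=[Nx,y]+[x,Ny]-N[x,y]$ and $[\![x,y,z]\!]_N=[\![Nx,Ny,z]\!]+[\![x,Ny,Nz]\!]+[\![Nx,y,Nz]\!]-N([\![Nx,y,z]\!]+[\![x,Ny,z]\!]+[\![x,y,Nz]\!])+N^2[\![x,y,z]\!]$, one has $[Nx,Ny]=N[x,y]_N$ and $[\![Nx,Ny,Nz]\!]=N[\![x,y,z]\!]_N$. Quadratic Lie-Yamaguti algebra: a Lie-Yamaguti algebra with a nondegenerate symmetric bilinear form $B$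 on $\mathfrak g$ satisfying $B([x,y],z)=-B(y,[x,z])$ and $B([\![x,y,z]\!],w)=B(x,[\![w,z,y]\!])$. $B$ induces a bijection $B^\sharp:\mathfrak g^*\to\mathfrak g$ by $B(x,y)=\langle(B^\sharp)^{-1}(x),y\rangle$. A skew-symmetric endomorphism of $(\mathfrak g,B)$ is a linear map $R:\mathfrak g\to\mathfrak g$ with $\langle\alpha,R\circ B^\sharp(\beta)\rangle+\langle\beta,R\circ B^\sharp(\alpha)\rangle=0$ for all $\alpha,\beta\in\mathfrak g^*$. $N^*:\mathfrak g^*\to\mathfrak g^*$ is the transpose, $\langle N^*\alpha,x\rangle=\langle\alpha,Nx\rangle$. For a general vector space $W$ with bilinear bracket $[\cdot,\cdot]'$ and trilinear bracket $[\![\cdot,\cdot,\cdot]\!]'$ and a linear map $S:W\to W$, the deformed brackets are $[u,v]'_S=[Su,v]'+[u,Sv]'-S[u,v]'$ and $[\![u,v,w]\!]'_S=[\![Su,Sv,w]\!]'+[\![Su,v,Sw]\!]'+[\![u,Sv,Sw]\!]'-S([\![Su,v,w]\!]'+[\![u,Sv,w]\!]'+[\![u,v,Sw]\!]')+S^2[\![u,v,w]\!]'$. Rota-Baxter-Nijenhuis structures: for a linear map $R:\mathfrak g\to\mathfrak g$ put $[x,y]^R=[Rx,y]-[Ry,x]$ and $[\![x,y,z]\!]^R=[\![Rx,Ry,z]\!]+[\![x,Ry,Rz]\!]-[\![y,Rx,Rz]\!]$. $R$ is a Rota-Baxter operator on $\mathfrak g$ if $[Rx,Ry]=R[x,y]^R$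 and $[\![Rx,Ry,Rz]\!]=R[\![x,y,z]\!]^R$. A pair $(R,N)$ consisting of a Rota-Baxter operator and a Nijenhuis operator is a Rota-Baxter-Nijenhuis structure if for all $x,y,z\in\mathfrak g$: $N\circ R=R\circ N$, $[x,y]^{N\circ R}=[x,y]^R_N$, $[\![x,y,z]\!]^{N\circ R}=[\![x,y,z]\!]^R_N$ (deformed brackets of $[\cdot,\cdot]^R,[\![\cdot,\cdot,\cdot]\!]^R$ by $N$). $r$-matrix-Nijenhuis structures: let $\mathrm{ad}_xz=[x,z]$, $\mathfrak R(x,y)z=[\![z,x,y]\!]$, $\mathfrak L(x,y)z=[\![x,y,z]\!]$, and let $\mathrm{ad}^*_x,\mathfrak R^*(x,y),\mathfrak L^*(x,y)$ be the negative transposes acting on $\mathfrak g^*$, e.g. $\langle\mathrm{ad}^*_x\alpha,z\rangle=-\langle\alpha,\mathrm{ad}_xz\rangle$. For a linear map $T:\mathfrak g^*\to\mathfrak g$ put $[\alpha,\beta]^T=\mathrm{ad}^*_{T\alpha}\beta-\mathrm{ad}^*_{T\beta}\alpha$ and $[\![\alpha,\beta,\gamma]\!]^T=\mathfrak L^*(T\alpha,T\beta)\gamma-\mathfrak R^*(T\gamma,T\beta)\alpha+\mathfrak R^*(T\gamma,T\alpha)\beta$. For $\pi\in\wedge^2\mathfrak g$ define $\pi^\sharp:\mathfrak g^*\to\mathfrak g$ by $\langle\pi^\sharp(\alpha),\beta\rangle=\pi(\alpha,\beta)$. $\pi$ is an $r$-matrix (classical Lie-Yamaguti $r$-matrix)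 if and only if $\pi^\sharp$ is a relative Rota-Baxter operator with respect to the coadjoint representation, i.e. $[\pi^\sharp\alpha,\pi^\sharp\beta]=\pi^\sharp[\alpha,\beta]^{\pi^\sharp}$ and $[\![\pi^\sharp\alpha,\pi^\sharp\beta,\pi^\sharp\gamma]\!]=\pi^\sharp[\![\alpha,\beta,\gamma]\!]^{\pi^\sharp}$ for all $\alpha,\beta,\gamma\in\mathfrak g^*$; take this as the definition. A pair $(\pi,N)$ of an $r$-matrix and a Nijenhuis operator is an $r$-matrix-Nijenhuis structure if for all $\alpha,\beta,\gamma\in\mathfrak g^*$: $N\circ\pi^\sharp=\pi^\sharp\circ N^*$, $[\alpha,\beta]^{N\circ\pi^\sharp}=[\alpha,\beta]^{\pi^\sharp}_{N^*}$, $[\![\alpha,\beta,\gamma]\!]^{N\circ\pi^\sharp}=[\![\alpha,\beta,\gamma]\!]^{\pi^\sharp}_{N^*}$ (deformed brackets of $[\cdot,\cdot]^{\pi^\sharp},[\![\cdot,\cdot,\cdot]\!]^{\pi^\sharp}$ by $N^*$). *)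

theory Defs
  imports Complex_Main "HOL-Library.Function_Algebras"
begin

text \<open>
  The vector space \<open>\<gg>\<close> is the whole type \<open>'g\<close>, with scalar multiplication
  \<open>scale\<close> over the field \<open>'k\<close> of characteristic 0.  Its dual is the set of linear functionals
  inside the type \<open>'g \<Rightarrow> 'k\<close>, whose addition is pointwise; the pairing of \<open>\<alpha>\<close> with \<open>x\<close>
  is \<open>\<alpha> x\<close>.  Maps defined on the dual are total functions on \<open>'g \<Rightarrow> 'k\<close>, and
  all conditions on them are imposed on the dual only.
\<close>

definition dual :: "('k::field \<Rightarrow> 'g::ab_group_add \<Rightarrow> 'g) \<Rightarrow> ('g \<Rightarrow> 'k) set" where
  "dual scale = {\<alpha>. Vector_Spaces.linear scale (*) \<alpha>}"

definition bilinear_map ::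
  "('k::field \<Rightarrow> 'v::ab_group_add \<Rightarrow> 'v) \<Rightarrow> ('k \<Rightarrow> 'w::ab_group_add \<Rightarrow> 'w) \<Rightarrow> ('v \<Rightarrow> 'v \<Rightarrow> 'w) \<Rightarrow> bool" where
  "bilinear_map s t f \<longleftrightarrow>
     (\<forall>x. Vector_Spaces.linear s t (\<lambda>y. f x y)) \<and> (\<forall>y. Vector_Spaces.linear s t (\<lambda>x. f x y))"

definition trilinear_map ::
  "('k::field \<Rightarrow> 'v::ab_group_add \<Rightarrow> 'v) \<Rightarrow> ('k \<Rightarrow> 'w::ab_group_add \<Rightarrow> 'w)
     \<Rightarrow> ('v \<Rightarrow> 'v \<Rightarrow> 'v \<Rightarrow> 'w) \<Rightarrow> bool" where
  "trilinear_map s t f \<longleftrightarrow>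
     (\<forall>y z. Vector_Spaces.linear s t (\<lambda>x. f x y z)) \<and>
     (\<forall>x z. Vector_Spaces.linear s t (\<lambda>y. f x y z)) \<and>
     (\<forall>x y. Vector_Spaces.linear s t (\<lambda>z. f x y z))"


section \<open>Lie-Yamaguti algebras\<close>

locale lie_yamaguti_algebra = finite_dimensional_vector_space scale Basis
  for scale :: "'k::field_char_0 \<Rightarrow> 'g::ab_group_add \<Rightarrow> 'g" and Basis :: "'g set" +
  fixes br :: "'g \<Rightarrow> 'g \<Rightarrow> 'g"
    and tr :: "'g \<Rightarrow> 'g \<Rightarrow> 'g \<Rightarrow> 'g"
  assumes br_bilinear: "bilinear_map scale scale br"
    and br_alternating: "br x x = 0"
    and tr_trilinear: "trilinear_map scale scale tr"
    and tr_alternating: "tr x x z = 0"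
    and cyclic_br:
      "br (br x y) z + br (br y z) x + br (br z x) y + tr x y z + tr y z x + tr z x y = 0"
    and cyclic_tr: "tr (br x y) z w + tr (br y z) x w + tr (br z x) y w = 0"
    and tr_br: "tr x y (br z w) = br (tr x y z) w + br z (tr x y w)"
    and tr_tr: "tr x y (tr z w t) = tr (tr x y z) w t + tr z (tr x y w) t + tr z w (tr x y t)"

locale quadratic_lie_yamaguti_algebra = lie_yamaguti_algebra scale Basis br tr
  for scale :: "'k::field_char_0 \<Rightarrow> 'g::ab_group_add \<Rightarrow> 'g" and Basis :: "'g set"
    and br :: "'g \<Rightarrow> 'g \<Rightarrow> 'g"
    and tr :: "'g \<Rightarrow> 'g \<Rightarrow> 'g \<Rightarrow> 'g" +
  fixes B :: "'g \<Rightarrow> 'g \<Rightarrow> 'k"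
  assumes form_bilinear: "bilinear_map scale (*) B"
    and form_symmetric: "B x y = B y x"
    and form_nondegenerate: "(\<forall>y. B x y = 0) \<Longrightarrow> x = 0"
    and form_br: "B (br x y) z = - B y (br x z)"
    and form_tr: "B (tr x y z) w = B x (tr w z y)"

text \<open>
  \<open>form_flat B\<close> is $(B^\sharp)^{-1}$ and \<open>form_sharp B\<close> is $B^\sharp$; see
  \<open>bij_betw_form_flat\<close> below.
\<close>

definition form_flat :: "('g \<Rightarrow> 'g \<Rightarrow> 'k) \<Rightarrow> 'g \<Rightarrow> ('g \<Rightarrow> 'k)" where
  "form_flat B x = (\<lambda>y. B x y)"

definition form_sharp :: "('g \<Rightarrow> 'g \<Rightarrow> 'k) \<Rightarrow> ('g \<Rightarrow> 'k) \<Rightarrow> 'g" where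
  "form_sharp B = the_inv (form_flat B)"

definition skew_symmetric_endomorphism ::
  "('k::field \<Rightarrow> 'g::ab_group_add \<Rightarrow> 'g) \<Rightarrow> ('g \<Rightarrow> 'g \<Rightarrow> 'k) \<Rightarrow> ('g \<Rightarrow> 'g) \<Rightarrow> bool" where
  "skew_symmetric_endomorphism scale B R \<longleftrightarrow>
     Vector_Spaces.linear scale scale R \<and>
     (\<forall>\<alpha>\<in>dual scale. \<forall>\<beta>\<in>dual scale.
        \<alpha> ((R \<circ> form_sharp B) \<beta>) + \<beta> ((R \<circ> form_sharp B) \<alpha>) = 0)"

definition dual_map :: "('g \<Rightarrow> 'g) \<Rightarrow> ('g \<Rightarrow> 'k) \<Rightarrow> ('g \<Rightarrow> 'k)" where
  "dual_map N \<alpha> = (\<lambda>x. \<alpha> (N x))"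


section \<open>Deformed brackets and Nijenhuis operators\<close>

definition deformed_br ::
  "('w \<Rightarrow> 'w \<Rightarrow> 'w) \<Rightarrow> ('w \<Rightarrow> 'w) \<Rightarrow> 'w \<Rightarrow> 'w \<Rightarrow> 'w::ab_group_add" where
  "deformed_br b S u v = b (S u) v + b u (S v) - S (b u v)"

definition deformed_tr ::
  "('w \<Rightarrow> 'w \<Rightarrow> 'w \<Rightarrow> 'w) \<Rightarrow> ('w \<Rightarrow> 'w) \<Rightarrow> 'w \<Rightarrow> 'w \<Rightarrow> 'w \<Rightarrow> 'w::ab_group_add" where
  "deformed_tr t S u v w =
     t (S u) (S v) w + t (S u) v (S w) + t u (S v) (S w)
     - S (t (S u) v w + t u (S v) w + t u v (S w)) + S (S (t u v w))"

definition nijenhuis_operator ::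
  "('k::field \<Rightarrow> 'g::ab_group_add \<Rightarrow> 'g) \<Rightarrow> ('g \<Rightarrow> 'g \<Rightarrow> 'g) \<Rightarrow> ('g \<Rightarrow> 'g \<Rightarrow> 'g \<Rightarrow> 'g)
     \<Rightarrow> ('g \<Rightarrow> 'g) \<Rightarrow> bool" where
  "nijenhuis_operator scale br tr N \<longleftrightarrow>
     Vector_Spaces.linear scale scale N \<and>
     (\<forall>x y. br (N x) (N y) = N (deformed_br br N x y)) \<and>
     (\<forall>x y z. tr (N x) (N y) (N z) = N (deformed_tr tr N x y z))"


section \<open>Rota-Baxter-Nijenhuis structures\<close>

definition rb_br :: "('g \<Rightarrow> 'g \<Rightarrow> 'g) \<Rightarrow> ('g \<Rightarrow> 'g) \<Rightarrow> 'g \<Rightarrow> 'g \<Rightarrow> 'g::ab_group_add" where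
  "rb_br br R x y = br (R x) y - br (R y) x"

definition rb_tr ::
  "('g \<Rightarrow> 'g \<Rightarrow> 'g \<Rightarrow> 'g) \<Rightarrow> ('g \<Rightarrow> 'g) \<Rightarrow> 'g \<Rightarrow> 'g \<Rightarrow> 'g \<Rightarrow> 'g::ab_group_add" where
  "rb_tr tr R x y z = tr (R x) (R y) z + tr x (R y) (R z) - tr y (R x) (R z)"

definition rota_baxter_operator ::
  "('k::field \<Rightarrow> 'g::ab_group_add \<Rightarrow> 'g) \<Rightarrow> ('g \<Rightarrow> 'g \<Rightarrow> 'g) \<Rightarrow> ('g \<Rightarrow> 'g \<Rightarrow> 'g \<Rightarrow> 'g)
     \<Rightarrow> ('g \<Rightarrow> 'g) \<Rightarrow> bool" where
  "rota_baxter_operator scale br tr R \<longleftrightarrow>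
     Vector_Spaces.linear scale scale R \<and>
     (\<forall>x y. br (R x) (R y) = R (rb_br br R x y)) \<and>
     (\<forall>x y z. tr (R x) (R y) (R z) = R (rb_tr tr R x y z))"

definition rota_baxter_nijenhuis ::
  "('k::field \<Rightarrow> 'g::ab_group_add \<Rightarrow> 'g) \<Rightarrow> ('g \<Rightarrow> 'g \<Rightarrow> 'g) \<Rightarrow> ('g \<Rightarrow> 'g \<Rightarrow> 'g \<Rightarrow> 'g)
     \<Rightarrow> ('g \<Rightarrow> 'g) \<Rightarrow> ('g \<Rightarrow> 'g) \<Rightarrow> bool" where
  "rota_baxter_nijenhuis scale br tr R N \<longleftrightarrow>
     rota_baxter_operator scale br tr R \<and>
     nijenhuis_operator scale br tr N \<and>
     N \<circ> R = R \<circ> N \<and>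
     (\<forall>x y. rb_br br (N \<circ> R) x y = deformed_br (rb_br br R) N x y) \<and>
     (\<forall>x y z. rb_tr tr (N \<circ> R) x y z = deformed_tr (rb_tr tr R) N x y z)"


section \<open>$r$-matrix-Nijenhuis structures\<close>

definition neg_transpose :: "('g \<Rightarrow> 'g) \<Rightarrow> ('g \<Rightarrow> 'k) \<Rightarrow> ('g \<Rightarrow> 'k::ab_group_add)" where
  "neg_transpose A \<alpha> = (\<lambda>z. - \<alpha> (A z))"

definition coad :: "('g \<Rightarrow> 'g \<Rightarrow> 'g) \<Rightarrow> 'g \<Rightarrow> ('g \<Rightarrow> 'k) \<Rightarrow> ('g \<Rightarrow> 'k::ab_group_add)" where
  "coad br x = neg_transpose (\<lambda>z. br x z)"

definition coR :: "('g \<Rightarrow> 'g \<Rightarrow> 'g \<Rightarrow> 'g) \<Rightarrow> 'g \<Rightarrow> 'g \<Rightarrow> ('g \<Rightarrow> 'k) \<Rightarrow> ('g \<Rightarrow> 'k::ab_group_add)" where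
  "coR tr x y = neg_transpose (\<lambda>z. tr z x y)"

definition coL :: "('g \<Rightarrow> 'g \<Rightarrow> 'g \<Rightarrow> 'g) \<Rightarrow> 'g \<Rightarrow> 'g \<Rightarrow> ('g \<Rightarrow> 'k) \<Rightarrow> ('g \<Rightarrow> 'k::ab_group_add)" where
  "coL tr x y = neg_transpose (\<lambda>z. tr x y z)"

definition dual_br ::
  "('g \<Rightarrow> 'g \<Rightarrow> 'g) \<Rightarrow> (('g \<Rightarrow> 'k) \<Rightarrow> 'g) \<Rightarrow> ('g \<Rightarrow> 'k) \<Rightarrow> ('g \<Rightarrow> 'k)
     \<Rightarrow> ('g \<Rightarrow> 'k::ab_group_add)" where
  "dual_br br T \<alpha> \<beta> = coad br (T \<alpha>) \<beta> - coad br (T \<beta>) \<alpha>"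

definition dual_tr ::
  "('g \<Rightarrow> 'g \<Rightarrow> 'g \<Rightarrow> 'g) \<Rightarrow> (('g \<Rightarrow> 'k) \<Rightarrow> 'g) \<Rightarrow> ('g \<Rightarrow> 'k) \<Rightarrow> ('g \<Rightarrow> 'k) \<Rightarrow> ('g \<Rightarrow> 'k)
     \<Rightarrow> ('g \<Rightarrow> 'k::ab_group_add)" where
  "dual_tr tr T \<alpha> \<beta> \<gamma> =
     coL tr (T \<alpha>) (T \<beta>) \<gamma> - coR tr (T \<gamma>) (T \<beta>) \<alpha> + coR tr (T \<gamma>) (T \<alpha>) \<beta>"

text \<open>
  An element of $\wedge^2\mathfrak g$ is given by its evaluation on pairs of functionals, i.e.\ as an
  alternating bilinear form on the dual; its values outside the dual are irrelevant.
\<close>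

definition bivectors ::
  "('k::field \<Rightarrow> 'g::ab_group_add \<Rightarrow> 'g) \<Rightarrow> (('g \<Rightarrow> 'k) \<Rightarrow> ('g \<Rightarrow> 'k) \<Rightarrow> 'k) set" where
  "bivectors scale = {\<pi>.
     (\<forall>\<alpha>\<in>dual scale. \<forall>\<beta>\<in>dual scale. \<forall>\<gamma>\<in>dual scale.
        \<pi> (\<alpha> + \<beta>) \<gamma> = \<pi> \<alpha> \<gamma> + \<pi> \<beta> \<gamma> \<and> \<pi> \<gamma> (\<alpha> + \<beta>) = \<pi> \<gamma> \<alpha> + \<pi> \<gamma> \<beta>) \<and>
     (\<forall>c. \<forall>\<alpha>\<in>dual scale. \<forall>\<beta>\<in>dual scale.
        \<pi> (\<lambda>x. c * \<alpha> x) \<beta> = c * \<pi> \<alpha> \<beta> \<and> \<pi> \<alpha> (\<lambda>x. c * \<beta> x) = c * \<pi> \<alpha> \<beta>) \<and>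
     (\<forall>\<alpha>\<in>dual scale. \<pi> \<alpha> \<alpha> = 0)}"

definition bivector_sharp ::
  "('k::field \<Rightarrow> 'g::ab_group_add \<Rightarrow> 'g) \<Rightarrow> (('g \<Rightarrow> 'k) \<Rightarrow> ('g \<Rightarrow> 'k) \<Rightarrow> 'k) \<Rightarrow> ('g \<Rightarrow> 'k) \<Rightarrow> 'g" where
  "bivector_sharp scale \<pi> \<alpha> = (THE x. \<forall>\<beta>\<in>dual scale. \<beta> x = \<pi> \<alpha> \<beta>)"

definition r_matrix ::
  "('k::field \<Rightarrow> 'g::ab_group_add \<Rightarrow> 'g) \<Rightarrow> ('g \<Rightarrow> 'g \<Rightarrow> 'g) \<Rightarrow> ('g \<Rightarrow> 'g \<Rightarrow> 'g \<Rightarrow> 'g)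
     \<Rightarrow> (('g \<Rightarrow> 'k) \<Rightarrow> ('g \<Rightarrow> 'k) \<Rightarrow> 'k) \<Rightarrow> bool" where
  "r_matrix scale br tr \<pi> \<longleftrightarrow>
     \<pi> \<in> bivectors scale \<and>
     (let T = bivector_sharp scale \<pi> in
       (\<forall>\<alpha>\<in>dual scale. \<forall>\<beta>\<in>dual scale. br (T \<alpha>) (T \<beta>) = T (dual_br br T \<alpha> \<beta>)) \<and>
       (\<forall>\<alpha>\<in>dual scale. \<forall>\<beta>\<in>dual scale. \<forall>\<gamma>\<in>dual scale.
          tr (T \<alpha>) (T \<beta>) (T \<gamma>) = T (dual_tr tr T \<alpha> \<beta> \<gamma>)))"

definition r_matrix_nijenhuis ::
  "('k::field \<Rightarrow> 'g::ab_group_add \<Rightarrow> 'g) \<Rightarrow> ('g \<Rightarrow> 'g \<Rightarrow> 'g) \<Rightarrow> ('g \<Rightarrow> 'g \<Rightarrow> 'g \<Rightarrow> 'g)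
     \<Rightarrow> (('g \<Rightarrow> 'k) \<Rightarrow> ('g \<Rightarrow> 'k) \<Rightarrow> 'k) \<Rightarrow> ('g \<Rightarrow> 'g) \<Rightarrow> bool" where
  "r_matrix_nijenhuis scale br tr \<pi> N \<longleftrightarrow>
     r_matrix scale br tr \<pi> \<and>
     nijenhuis_operator scale br tr N \<and>
     (let T = bivector_sharp scale \<pi> in
       (\<forall>\<alpha>\<in>dual scale. (N \<circ> T) \<alpha> = (T \<circ> dual_map N) \<alpha>) \<and>
       (\<forall>\<alpha>\<in>dual scale. \<forall>\<beta>\<in>dual scale.
          dual_br br (N \<circ> T) \<alpha> \<beta> = deformed_br (dual_br br T) (dual_map N) \<alpha> \<beta>) \<and>
       (\<forall>\<alpha>\<in>dual scale. \<forall>\<beta>\<in>dual scale. \<forall>\<gamma>\<in>dual scale.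
          dual_tr tr (N \<circ> T) \<alpha> \<beta> \<gamma> = deformed_tr (dual_tr tr T) (dual_map N) \<alpha> \<beta> \<gamma>))"


section \<open>Well-definedness of the musical maps\<close>

context quadratic_lie_yamaguti_algebra
begin

lemma dual_iff:
  "\<alpha> \<in> dual scale \<longleftrightarrow> (\<forall>x y. \<alpha> (x + y) = \<alpha> x + \<alpha> y) \<and> (\<forall>c x. \<alpha> (scale c x) = c * \<alpha> x)"
proof -
  have "vector_space ((*) :: 'k \<Rightarrow> 'k \<Rightarrow> 'k)"
    by unfold_locales (simp_all add: algebra_simps)
  then show ?thesis
    unfolding dual_def Vector_Spaces.linear_iff using vector_space_axioms by auto
qed

lemma form_linear:
  "B (x + y) z = B x z + B y z" "B z (x + y) = B z x + B z y"
  "B (scale c x) z = c * B x z" "B z (scale c x) = c * B z x"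
  using form_bilinear unfolding bilinear_map_def Vector_Spaces.linear_iff by blast+

lemma inj_form_flat: "inj (form_flat B)"
proof (rule injI)
  fix x y assume "form_flat B x = form_flat B y"
  then have "B x z = B y z" for z by (auto simp: form_flat_def dest: fun_cong)
  moreover have "B x z = B (x - y) z + B y z" for z
    using form_linear(1)[of "x - y" y z] by simp
  ultimately have "\<forall>z. B (x - y) z = 0" by simp
  then show "x = y" using form_nondegenerate by fastforce
qed

lemma dual_sum:
  assumes "\<alpha> \<in> dual scale" "finite S"
  shows "\<alpha> (\<Sum>b\<in>S. scale (c b) b) = (\<Sum>b\<in>S. c b * \<alpha> b)"
proof -
  have "\<alpha> 0 = 0" using assms(1) unfolding dual_iff by (metis add_cancel_left_left)
  moreover have "\<alpha> (x + y) = \<alpha> x + \<alpha> y" "\<alpha> (scale r x) = r * \<alpha> x" for x y r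
    using assms(1) unfolding dual_iff by blast+
  ultimately show ?thesis
    using assms(2) by (induction S rule: infinite_finite_induct) simp_all
qed

lemma dual_eqI:
  assumes "\<alpha> \<in> dual scale" "\<beta> \<in> dual scale" "\<And>b. b \<in> Basis \<Longrightarrow> \<alpha> b = \<beta> b"
  shows "\<alpha> = \<beta>"
proof
  fix x
  have "x \<in> span Basis" by (simp add: span_Basis)
  then obtain c where x: "x = (\<Sum>b\<in>Basis. scale (c b) b)"
    unfolding span_finite[OF finite_Basis] by auto
  show "\<alpha> x = \<beta> x"
    unfolding x dual_sum[OF assms(1) finite_Basis] dual_sum[OF assms(2) finite_Basis]
    using assms(3) by simp
qed

lemma form_flat_dual: "form_flat B x \<in> dual scale"
  by (simp add: form_flat_def dual_iff form_linear)

lemma bij_betw_form_flat: "bij_betw (form_flat B) UNIV (dual scale)"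
  unfolding bij_betw_def
proof (intro conjI inj_form_flat equalityI subsetI)
  fix \<alpha> assume "\<alpha> \<in> range (form_flat B)"
  then show "\<alpha> \<in> dual scale" using form_flat_dual by auto
next
  fix \<alpha> assume \<alpha>: "\<alpha> \<in> dual scale"
  define h where "h x = (\<Sum>b\<in>Basis. scale (B x b) b)" for x
  have coeff: "\<forall>b\<in>Basis. c b = d b"
    if eq: "(\<Sum>b\<in>Basis. scale (c b) b) = (\<Sum>b\<in>Basis. scale (d b) b)" for c d :: "'g \<Rightarrow> 'k"
  proof -
    have sum0: "(\<Sum>b\<in>Basis. scale (c b - d b) b) = 0"
      using eq by (simp add: scale_left_diff_distrib sum_subtractf)
    have "c b - d b = 0" if "b \<in> Basis" for b
      by (rule independentD[OF independent_Basis finite_Basis order.refl sum0 that])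
    then show ?thesis by simp
  qed
  have "h (x + y) = h x + h y" for x y
    by (simp add: h_def form_linear(1) scale_left_distrib sum.distrib)
  moreover have "h (scale c x) = scale c (h x)" for c x
    unfolding h_def form_linear(3) scale_sum_right scale_scale ..
  ultimately have "Vector_Spaces.linear scale scale h"
    unfolding Vector_Spaces.linear_iff using vector_space_axioms by blast
  moreover have "inj h"
  proof (rule injI)
    fix x y assume "h x = h y"
    then have "form_flat B x b = form_flat B y b" if "b \<in> Basis" for b
      using coeff[of "B x" "B y"] that by (simp add: h_def form_flat_def)
    then have "form_flat B x = form_flat B y" using dual_eqI form_flat_dual by blast
    then show "x = y" using inj_form_flat by (auto dest: injD)
  qed
  ultimately have "surj h" by (rule linear_inj_imp_surj)
  then obtain x where "h x = (\<Sum>b\<in>Basis. scale (\<alpha> b) b)" by (metis surjD)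
  then have "\<forall>b\<in>Basis. B x b = \<alpha> b" unfolding h_def by (rule coeff)
  then have "form_flat B x = \<alpha>"
    using dual_eqI[OF form_flat_dual \<alpha>] by (simp add: form_flat_def)
  then show "\<alpha> \<in> range (form_flat B)" by auto
qed

lemma form_sharp_flat: "form_sharp B (form_flat B x) = x"
  unfolding form_sharp_def by (rule the_inv_f_f[OF inj_form_flat])

lemma form_flat_sharp: "\<alpha> \<in> dual scale \<Longrightarrow> form_flat B (form_sharp B \<alpha>) = \<alpha>"
  using bij_betw_form_flat form_sharp_flat unfolding bij_betw_def by (metis rangeE)

lemma bivector_sharp_eqI:
  assumes "\<And>\<beta>. \<beta> \<in> dual scale \<Longrightarrow> \<beta> x = \<pi> \<alpha> \<beta>"
  shows "bivector_sharp scale \<pi> \<alpha> = x"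
  unfolding bivector_sharp_def
proof (rule the_equality)
  fix y assume y: "\<forall>\<beta>\<in>dual scale. \<beta> y = \<pi> \<alpha> \<beta>"
  have "form_flat B z y = form_flat B z x" for z
    using y assms form_flat_dual by simp
  then have "form_flat B y = form_flat B x"
    unfolding form_flat_def by (intro ext) (metis form_symmetric)
  then show "y = x" using inj_form_flat by (auto dest: injD)
qed (use assms in simp)

text \<open>Every skew-symmetric endomorphism $R$ does come from a bivector.\<close>

lemma ex_bivector:
  assumes "skew_symmetric_endomorphism scale B R"
  shows "\<exists>\<pi>\<in>bivectors scale. \<forall>\<alpha>\<in>dual scale. bivector_sharp scale \<pi> \<alpha> = (R \<circ> form_sharp B) \<alpha>"
proof -
  define \<pi> :: "('g \<Rightarrow> 'k) \<Rightarrow> ('g \<Rightarrow> 'k) \<Rightarrow> 'k" where "\<pi> \<alpha> \<beta> = \<beta> (R (form_sharp B \<alpha>))" for \<alpha> \<beta>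
  have skew: "\<pi> \<alpha> \<beta> = - \<pi> \<beta> \<alpha>" if "\<alpha> \<in> dual scale" "\<beta> \<in> dual scale" for \<alpha> \<beta>
    using assms that unfolding skew_symmetric_endomorphism_def \<pi>_def
    by (simp add: eq_neg_iff_add_eq_0)
  have sum: "\<alpha> + \<beta> \<in> dual scale" and smult: "(\<lambda>x. c * \<alpha> x) \<in> dual scale"
    if "\<alpha> \<in> dual scale" "\<beta> \<in> dual scale" for \<alpha> \<beta> c
    using that unfolding dual_iff by (auto simp: algebra_simps)
  have alt: "\<pi> \<alpha> \<alpha> = 0" if "\<alpha> \<in> dual scale" for \<alpha>
  proof -
    have "\<pi> \<alpha> \<alpha> + \<pi> \<alpha> \<alpha> = 0"
      using skew[OF that that] by (rule eq_neg_iff_add_eq_0[THEN iffD1])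
    then have "2 * \<pi> \<alpha> \<alpha> = 0" unfolding mult_2 .
    then show ?thesis by simp
  qed
  have right: "\<pi> \<gamma> (\<alpha> + \<beta>) = \<pi> \<gamma> \<alpha> + \<pi> \<gamma> \<beta>" "\<pi> \<gamma> (\<lambda>x. c * \<alpha> x) = c * \<pi> \<gamma> \<alpha>" for \<alpha> \<beta> \<gamma> c
    by (simp_all add: \<pi>_def)
  have left: "\<pi> (\<alpha> + \<beta>) \<gamma> = \<pi> \<alpha> \<gamma> + \<pi> \<beta> \<gamma>" "\<pi> (\<lambda>x. c * \<alpha> x) \<gamma> = c * \<pi> \<alpha> \<gamma>"
    if "\<alpha> \<in> dual scale" "\<beta> \<in> dual scale" "\<gamma> \<in> dual scale" for \<alpha> \<beta> \<gamma> c
    unfolding skew[OF sum[OF that(1,2)] that(3)] skew[OF smult[OF that(1,1)] that(3)]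
      skew[OF that(1,3)] skew[OF that(2,3)] right by simp_all
  have "\<pi> \<in> bivectors scale"
    unfolding bivectors_def using left right alt by auto
  moreover have "bivector_sharp scale \<pi> \<alpha> = (R \<circ> form_sharp B) \<alpha>" for \<alpha>
    by (rule bivector_sharp_eqI) (simp add: \<pi>_def)
  ultimately show ?thesis by blast
qed

end

end

theory Submission
  imports Defs
begin

text \<open>
  The form identifies $\mathfrak g$ with $\mathfrak g^*$ through the linear bijection
  \<open>form_flat B\<close>, and the theorem holds because this identification carries every ingredient of
  one structure to the matching ingredient of the other; both implications are thus the two
  directions of a single equivalence.

  Invariance of the form says that the adjoint and coadjoint representations correspond:
  $\mathrm{ad}^*_x$ becomes $\mathrm{ad}_x$, $\mathfrak L^*(x,y)$ becomes $\mathfrak L(x,y)$, and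
  $\mathfrak R^*(x,y)$ becomes $-\mathfrak R(y,x)$.  Consequently, if $T$ is a map from the dual that
  corresponds to the endomorphism $P$, the brackets defined by $T$ on the dual are the images of
  the brackets defined by $P$ on $\mathfrak g$ (\<open>dual_br_form_flat\<close>,
  \<open>dual_tr_form_flat\<close>).  This is used twice, for $\pi^\sharp$ with $R$ and for
  $N\circ\pi^\sharp$ with $N\circ R$.  Compatibility of the form with $N$ says that $N^*$
  corresponds to $N$ (\<open>dual_map_form_flat\<close>), so the deformed brackets correspond as well
  (\<open>additive_deformed_br\<close>, \<open>additive_deformed_tr\<close>).  Each identity between
  functionals is then the image of one between vectors, and injectivity of the identification makes
  the two equivalent; surjectivity turns quantification over the dual into quantification over
  $\mathfrak g$.
\<close>

lemma additive_deformed_br: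
  assumes "additive f"
    and S: "\<And>x. S' (f x) = f (S x)"
    and b: "\<And>x y. b' (f x) (f y) = f (b x y)"
  shows "deformed_br b' S' (f x) (f y) = f (deformed_br b S x y)"
  by (simp add: deformed_br_def S b additive.add[OF assms(1)] additive.diff[OF assms(1)])

lemma additive_deformed_tr:
  assumes "additive f"
    and S: "\<And>x. S' (f x) = f (S x)"
    and t: "\<And>x y z. t' (f x) (f y) (f z) = f (t x y z)"
  shows "deformed_tr t' S' (f x) (f y) (f z) = f (deformed_tr t S x y z)"
  by (simp add: deformed_tr_def S t additive.add[OF assms(1), symmetric]
      additive.diff[OF assms(1), symmetric])

context lie_yamaguti_algebra
begin

lemma tr_skew: "tr y x z = - tr x y z"
proof -
  have add: "tr (a + b) c z = tr a c z + tr b c z" "tr c (a + b) z = tr c a z + tr c b z" for a b c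
    using tr_trilinear unfolding trilinear_map_def Vector_Spaces.linear_iff by blast+
  have "tr y x z + tr x y z = tr (x + y) (x + y) z"
    unfolding add by (simp add: tr_alternating add.commute)
  also have "\<dots> = 0" by (rule tr_alternating)
  finally show ?thesis by (rule eq_neg_iff_add_eq_0[THEN iffD2])
qed

end

context quadratic_lie_yamaguti_algebra
begin

lemma additive_form_flat: "additive (form_flat B)"
  by unfold_locales (simp add: form_flat_def form_linear fun_eq_iff)

lemma form_minus: "B (- x) y = - B x y" "B x (- y) = - B x y"
  using form_linear(3)[of "- 1" x y] form_linear(4)[of x "- 1" y] by simp_all

lemma form_flat_eq_iff: "form_flat B x = form_flat B y \<longleftrightarrow> x = y"
  using inj_form_flat by (auto dest: injD)

lemma ball_dual_iff: "(\<forall>\<alpha>\<in>dual scale. P \<alpha>) \<longleftrightarrow> (\<forall>x. P (form_flat B x))"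
  using bij_betw_imp_surj_on[OF bij_betw_form_flat, symmetric] by simp

lemma coad_form_flat: "coad br x (form_flat B y) = form_flat B (br x y)"
  by (simp add: coad_def neg_transpose_def form_flat_def form_br)

lemma coR_form_flat: "coR tr x y (form_flat B w) = - form_flat B (tr w y x)"
proof
  fix z
  have "B (tr w y x) z = B w (tr z x y)" by (rule form_tr)
  then show "coR tr x y (form_flat B w) z = (- form_flat B (tr w y x)) z"
    by (simp add: coR_def neg_transpose_def form_flat_def)
qed

text \<open>
  The invariance axiom for the ternary bracket moves the right multiplications across the form.
  Applying it twice, with skew-symmetry in the first two arguments in between, makes the left
  multiplications skew for the form.
\<close>

lemma coL_form_flat: "coL tr x y (form_flat B w) = form_flat B (tr x y w)"
proof
  fix z
  have "B (tr x y w) z = B x (tr z w y)" by (rule form_tr)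
  also have "\<dots> = - B x (tr w z y)" by (simp add: tr_skew[of z w] form_minus)
  also have "B x (tr w z y) = B (tr w z y) x" by (rule form_symmetric)
  also have "\<dots> = B w (tr x y z)" by (rule form_tr)
  finally show "coL tr x y (form_flat B w) z = form_flat B (tr x y w) z"
    by (simp add: coL_def neg_transpose_def form_flat_def)
qed

lemma dual_br_form_flat:
  assumes "\<And>x. T (form_flat B x) = P x"
  shows "dual_br br T (form_flat B x) (form_flat B y) = form_flat B (rb_br br P x y)"
  by (simp add: dual_br_def rb_br_def assms coad_form_flat additive.diff[OF additive_form_flat])

lemma dual_tr_form_flat:
  assumes "\<And>x. T (form_flat B x) = P x"
  shows "dual_tr tr T (form_flat B x) (form_flat B y) (form_flat B z)
    = form_flat B (rb_tr tr P x y z)"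
  by (simp add: dual_tr_def rb_tr_def assms coL_form_flat coR_form_flat
      additive.add[OF additive_form_flat] additive.diff[OF additive_form_flat])

lemma dual_map_form_flat:
  assumes "Vector_Spaces.linear scale scale N"
    and compat: "\<forall>\<alpha>\<in>dual scale. (form_sharp B \<circ> dual_map N) \<alpha> = (N \<circ> form_sharp B) \<alpha>"
  shows "dual_map N (form_flat B x) = form_flat B (N x)"
proof -
  have "dual_map N (form_flat B x) \<in> dual scale"
    using assms(1) unfolding dual_iff Vector_Spaces.linear_iff
    by (simp add: dual_map_def form_flat_def form_linear)
  then have "dual_map N (form_flat B x) = form_flat B (form_sharp B (dual_map N (form_flat B x)))"
    by (simp add: form_flat_sharp)
  also have "form_sharp B (dual_map N (form_flat B x)) = N x"
    using compat form_flat_dual by (simp add: form_sharp_flat)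
  finally show ?thesis .
qed

lemma r_matrix_iff_rota_baxter_operator:
  assumes "\<pi> \<in> bivectors scale" "Vector_Spaces.linear scale scale R"
    and T: "\<And>x. bivector_sharp scale \<pi> (form_flat B x) = R x"
  shows "r_matrix scale br tr \<pi> \<longleftrightarrow> rota_baxter_operator scale br tr R"
  using assms(1,2)
  by (simp add: r_matrix_def rota_baxter_operator_def ball_dual_iff T
      dual_br_form_flat[of "bivector_sharp scale \<pi>" R, OF T]
      dual_tr_form_flat[of "bivector_sharp scale \<pi>" R, OF T])

lemma r_matrix_nijenhuis_iff_rota_baxter_nijenhuis:
  assumes "\<pi> \<in> bivectors scale" "Vector_Spaces.linear scale scale R"
    and T: "\<And>x. bivector_sharp scale \<pi> (form_flat B x) = R x"
    and N: "\<And>x. dual_map N (form_flat B x) = form_flat B (N x)"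
  shows "r_matrix_nijenhuis scale br tr \<pi> N \<longleftrightarrow> rota_baxter_nijenhuis scale br tr R N"
proof -
  let ?T = "bivector_sharp scale \<pi>" and ?f = "form_flat B"
  have NT: "(N \<circ> ?T) (?f x) = (N \<circ> R) x" for x
    by (simp add: T)
  have commute: "(N \<circ> ?T) (?f x) = (?T \<circ> dual_map N) (?f x) \<longleftrightarrow> (N \<circ> R) x = (R \<circ> N) x" for x
    by (simp add: T N)
  have deformed_br: "deformed_br (dual_br br ?T) (dual_map N) (?f x) (?f y)
      = ?f (deformed_br (rb_br br R) N x y)" for x y
    by (rule additive_deformed_br[where f = ?f]) (rule additive_form_flat N dual_br_form_flat T)+
  have deformed_tr: "deformed_tr (dual_tr tr ?T) (dual_map N) (?f x) (?f y) (?f z)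
      = ?f (deformed_tr (rb_tr tr R) N x y z)" for x y z
    by (rule additive_deformed_tr[where f = ?f]) (rule additive_form_flat N dual_tr_form_flat T)+
  show ?thesis
    unfolding r_matrix_nijenhuis_def rota_baxter_nijenhuis_def Let_def ball_dual_iff
      r_matrix_iff_rota_baxter_operator[OF assms(1-3)] commute deformed_br deformed_tr
      dual_br_form_flat[of "N \<circ> ?T" "N \<circ> R", OF NT] dual_tr_form_flat[of "N \<circ> ?T" "N \<circ> R", OF NT]
      form_flat_eq_iff fun_eq_iff[of "N \<circ> R"] ..
qed

end

theorem theorem5p10:
  fixes scale :: "'k::field_char_0 \<Rightarrow> 'g::ab_group_add \<Rightarrow> 'g"
    and Basis :: "'g set"
    and br :: "'g \<Rightarrow> 'g \<Rightarrow> 'g"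
    and tr :: "'g \<Rightarrow> 'g \<Rightarrow> 'g \<Rightarrow> 'g"
    and B :: "'g \<Rightarrow> 'g \<Rightarrow> 'k"
    and N R :: "'g \<Rightarrow> 'g"
    and \<pi> :: "('g \<Rightarrow> 'k) \<Rightarrow> ('g \<Rightarrow> 'k) \<Rightarrow> 'k"
  assumes "quadratic_lie_yamaguti_algebra scale Basis br tr B"
    and "nijenhuis_operator scale br tr N"
    and "skew_symmetric_endomorphism scale B R"
    and "\<pi> \<in> bivectors scale"
    and "\<forall>\<alpha>\<in>dual scale. bivector_sharp scale \<pi> \<alpha> = (R \<circ> form_sharp B) \<alpha>"
    and "\<forall>\<alpha>\<in>dual scale. (form_sharp B \<circ> dual_map N) \<alpha> = (N \<circ> form_sharp B) \<alpha>"
  shows "(rota_baxter_nijenhuis scale br tr R N \<longrightarrow> r_matrix_nijenhuis scale br tr \<pi> N) \<and>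
    (r_matrix_nijenhuis scale br tr \<pi> N \<longrightarrow>
       rota_baxter_nijenhuis scale br tr (bivector_sharp scale \<pi> \<circ> form_flat B) N)"
proof -
  interpret quadratic_lie_yamaguti_algebra scale Basis br tr B by (rule assms(1))
  have T: "bivector_sharp scale \<pi> (form_flat B x) = R x" for x
    using assms(5) form_flat_dual by (simp add: form_sharp_flat)
  have R_eq: "bivector_sharp scale \<pi> \<circ> form_flat B = R"
    by (simp add: fun_eq_iff T)
  have R_linear: "Vector_Spaces.linear scale scale R"
    using assms(3) by (simp add: skew_symmetric_endomorphism_def)
  have "Vector_Spaces.linear scale scale N"
    using assms(2) by (simp add: nijenhuis_operator_def)
  then have "dual_map N (form_flat B x) = form_flat B (N x)" for x
    using assms(6) by (rule dual_map_form_flat)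
  then have "r_matrix_nijenhuis scale br tr \<pi> N \<longleftrightarrow> rota_baxter_nijenhuis scale br tr R N"
    by (rule r_matrix_nijenhuis_iff_rota_baxter_nijenhuis[OF assms(4) R_linear T])
  then show ?thesis unfolding R_eq by blast
qed

end
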